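(* Let $\hat A\in\mathbb{R}^{n_o\times n_e}$ have full row rank $n_o\le n_e$, let $L\in\mathbb{R}^{n_o\times n_o}$ be symmetric positive semi-definite, and consider the staggered SBP-FD/SAT semi-discretization (see context) on an interval $I=(x_L,x_R)$ of the one-dimensional problem $$\partial_tu^o+\hat A\,\partial_xu^e=0,\quad\partial_tu^e+\hat A^T\partial_xu^o=0\ \text{ in }I,\qquad u^o=-L\hat Au^e+g_L\ \text{ at }x_L,\quad u^o=L\hat Au^e+g_R\ \text{ at }x_R,$$ with boundary sources $g_L(t),g_R(t)\in\operatorname{Im}(L)$, penalization matrices $\tau_0^o,\tau_N^o\in\mathbb{R}^{n_o\times n_o}$, and $$\tau_0^e=-(\hat A+\tau_0^oL\hat A)^T,\qquad\tau_N^e=(\hat A+\tau_N^oL\hat A)^T .$$ Then the solutions of the semi-discrete system satisfy (for all initial grid data $(u_0^o)_{h_o},(u_0^e)_{h_e}$, all boundary sources $g_L,g_R$ with values in $\operatorname{Im}(L)$, and all $T>0$) the energy bound $$\|u^o_{h_o}(T)\|^2_{h_o}+\|u^e_{h_e}(T)\|^2_{h_e}\le\|(u_0^o)_{h_o}\|^2_{h_o}+\|(u_0^e)_{h_e}\|^2_{h_e}+C\left(\|g_L\|^2_{L^2(0,T)}+\|g_R\|^2_{L^2(0,T)}\right)$$ with $$C=\max\left\{\|\tau^o_\star\|_2,\ \|L^++(\tau^o_\star)^T\|_2\ :\ \star\in\{0,N\}\right\}$$ if and only if, for each $\star\in\{0,N\}$, $\tau^o_\star$ is negative semi-definite and $$x^TL(-\tau^o_\star)^TLx\le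 x^TLx\qquad\text{for all }x\in\mathbb{R}^{n_o}.$$
   Context: Negative semi-definite for a square matrix $M$ means $x^TMx\le0$ for all $x$. Grids: with $x_i=x_L+i\,\Delta x$, $\Delta x=(x_R-x_L)/N$, the odd grid has nodes $x^o=(x_0,x_1,\dots,x_N)$ ($N+1$ nodes) and the even grid has nodes $x^e=(x_0,x_{1/2},x_{3/2},\dots,x_{N-1/2},x_N)$ ($N+2$ nodes), where $x_0=x_L$, $x_N=x_R$. Grid functions $f_{h_o}$, $f_{h_e}$ assign a vector to each node of the odd, respectively even, grid; subscripts $0$ and $N$ on a grid function denote its values at the left and right boundary node. A matrix $M$ acts on grid functions by $(\mathcal Mf)_i=\sum_jM_{ij}f_j$. $\langle f_h,g_h\rangle=\sum_if_{h,i}^Tg_{h,i}$. Staggered SBP-FD operators: $D^{e\to o}=(P^o)^{-1}Q^o$, mapping even to odd grid functions, and $D^{o\to e}=(P^e)^{-1}Q^e$, mapping odd to even, with $P^o\in\mathbb{R}^{(N+1)\times(N+1)}$, $P^e\in\mathbb{R}^{(N+2)\times(N+2)}$, $Q^o\in\mathbb{R}^{(N+1)\times(N+2)}$, $Q^e\in\mathbb{R}^{(N+2)\times(N+1)}$ such that: (i) accuracy: the operators differentiate monomials $x^k$ exactly for $k=0,\dots,s$ at boundary nodes and for $k=0,\dots,2s$ at internal nodes, for some $s\in\mathbb{N}$; (ii) SBP property: $Q^o+(Q^e)^T=B$ where $\langle f_{h_o},\mathcal Bg_{h_e}\rangle=f_{h_o,N}^Tg_{h_e,N}-f_{h_o,0}^Tg_{h_e,0}$;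 (iii) $P^o,P^e$ are diagonal positive definite, defining the norms $\|f_{h_o}\|_{h_o}^2=\langle f_{h_o},\mathcal P^of_{h_o}\rangle$ and $\|f_{h_e}\|_{h_e}^2=\langle f_{h_e},\mathcal P^ef_{h_e}\rangle$. Semi-discrete system: an ODE system for grid functions $u^o_{h_o}(t)$ (values in $\mathbb{R}^{n_o}$) and $u^e_{h_e}(t)$ (values in $\mathbb{R}^{n_e}$), $$\partial_tu^o_{h_o}+\mathcal D^{e\to o}(\hat Au^e_{h_e})=S^o,\qquad\partial_tu^e_{h_e}+\mathcal D^{o\to e}(\hat A^Tu^o_{h_o})=S^e,$$ where the simultaneous approximation terms $S^a$ ($a\in\{o,e\}$) vanish except at the boundary nodes, where $$S^a_0=(p^a_0)^{-1}\tau^a_0\big(u^o_{h_o,0}+L\hat Au^e_{h_e,0}-g_L\big),\qquad S^a_N=(p^a_N)^{-1}\tau^a_N\big(u^o_{h_o,N}-L\hat Au^e_{h_e,N}-g_R\big),$$ with $p^a_0,p^a_N$ the diagonal entries of $P^a$ belonging to the left and right boundary node, $\tau^o_\star\in\mathbb{R}^{n_o\times n_o}$, $\tau^e_\star\in\mathbb{R}^{n_e\times n_o}$. The initial values are $(u^o_0)_{h_o}$, $(u^e_0)_{h_e}$. $L^+$ is the pseudo-inverse of $L$; $\|\cdot\|_2$ is the operator (spectral) norm; $\|g\|^2_{L^2(0,T)}=\int_0^Tg^Tg\,dt$.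
   Formalization: The "if" direction (condition implies energy bound) is stated only for symmetric penalization matrices τ^o_0, τ^o_N, since it fails without symmetry (e.g. Â=L=I, τ^o a rotation by 90 degrees); the "only if" direction holds for all τ^o. *)

theory Defs
  imports "HOL-Analysis.Analysis"
begin

text \<open>
  Grid functions and node matrices are indexed by \<open>nat\<close>; only the indices \<open>0..n\<close> are
  relevant, where \<open>n\<close> is the index of the right boundary node.  For \<open>N\<close> cells the odd grid has
  \<open>n = N\<close>; the even grid has \<open>n = N + 1\<close>, the index \<open>j\<close> with \<open>1 \<le> j \<le> N\<close> standing for the
  midpoint \<open>x\<^bsub>j-1/2\<^esub>\<close>.
\<close>

definition odd_node :: "real \<Rightarrow> real \<Rightarrow> nat \<Rightarrow> nat \<Rightarrow> real" where
  "odd_node xL xR N i = xL + real i * ((xR - xL) / real N)"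

definition even_node :: "real \<Rightarrow> real \<Rightarrow> nat \<Rightarrow> nat \<Rightarrow> real" where
  "even_node xL xR N j =
     (if j = 0 then xL else if j = N + 1 then xR
      else xL + (real j - 1/2) * ((xR - xL) / real N))"

definition grid_apply ::
  "nat \<Rightarrow> (nat \<Rightarrow> nat \<Rightarrow> real) \<Rightarrow> (nat \<Rightarrow> 'v::real_vector) \<Rightarrow> nat \<Rightarrow> 'v" where
  "grid_apply n M f i = (\<Sum>j\<le>n. M i j *\<^sub>R f j)"

definition grid_inner :: "nat \<Rightarrow> (nat \<Rightarrow> 'v::real_inner) \<Rightarrow> (nat \<Rightarrow> 'v) \<Rightarrow> real" where
  "grid_inner n f g = (\<Sum>i\<le>n. f i \<bullet> g i)"

definition grid_norm_sq ::
  "nat \<Rightarrow> (nat \<Rightarrow> nat \<Rightarrow> real) \<Rightarrow> (nat \<Rightarrow> 'v::real_inner) \<Rightarrow> real" where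
  "grid_norm_sq n P f = grid_inner n f (grid_apply n P f)"

definition diag_pos_def :: "nat \<Rightarrow> (nat \<Rightarrow> nat \<Rightarrow> real) \<Rightarrow> bool" where
  "diag_pos_def n P \<longleftrightarrow>
     (\<forall>i\<le>n. \<forall>j\<le>n. i \<noteq> j \<longrightarrow> P i j = 0) \<and>
     (\<forall>x :: nat \<Rightarrow> real. (\<exists>i\<le>n. x i \<noteq> 0) \<longrightarrow> grid_inner n x (grid_apply n P x) > 0)"

text \<open>The entries of \<open>P\<^sup>-\<^sup>1 Q\<close> for a diagonal matrix \<open>P\<close>.\<close>

definition sbp_diff ::
  "(nat \<Rightarrow> nat \<Rightarrow> real) \<Rightarrow> (nat \<Rightarrow> nat \<Rightarrow> real) \<Rightarrow> nat \<Rightarrow> nat \<Rightarrow> real" where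
  "sbp_diff P Q i j = Q i j / P i i"

text \<open>The operator \<open>D\<close> maps grid functions on the nodes \<open>x 0, \<dots>, x n\<close> to grid functions on the
  nodes \<open>y 0, \<dots>, y m\<close>.\<close>

definition sbp_accurate ::
  "nat \<Rightarrow> nat \<Rightarrow> (nat \<Rightarrow> real) \<Rightarrow> nat \<Rightarrow> (nat \<Rightarrow> real) \<Rightarrow> (nat \<Rightarrow> nat \<Rightarrow> real) \<Rightarrow> bool" where
  "sbp_accurate s n x m y D \<longleftrightarrow>
     (\<forall>i\<le>m. \<forall>k \<le> (if i = 0 \<or> i = m then s else 2 * s).
        grid_apply n D (\<lambda>j. x j ^ k) i = real k * y i ^ (k - 1))"

definition boundary_matrix :: "nat \<Rightarrow> nat \<Rightarrow> nat \<Rightarrow> real" where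
  "boundary_matrix N i j =
     (if i = N \<and> j = N + 1 then 1 else 0) - (if i = 0 \<and> j = 0 then 1 else 0)"

lemma grid_inner_boundary_matrix:
  fixes f g :: "nat \<Rightarrow> 'v::real_inner"
  shows "grid_inner N f (grid_apply (N + 1) (boundary_matrix N) g)
           = f N \<bullet> g (N + 1) - f 0 \<bullet> g 0"
proof -
  have "grid_apply (N + 1) (boundary_matrix N) g i =
      (if i = N then g (N + 1) else 0) - (if i = 0 then g 0 else 0)" for i
  proof -
    have "boundary_matrix N i j *\<^sub>R g j =
        (if j = N + 1 then (if i = N then g j else 0) else 0)
        - (if j = 0 then (if i = 0 then g j else 0) else 0)" for j
      by (auto simp: boundary_matrix_def scaleR_diff_left)
    then show ?thesis
      by (simp add: grid_apply_def sum_subtractf del: sum.atMost_Suc)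
  qed
  then have "grid_inner N f (grid_apply (N + 1) (boundary_matrix N) g) =
      (\<Sum>i\<le>N. (if i = N then f i \<bullet> g (N + 1) else 0) - (if i = 0 then f i \<bullet> g 0 else 0))"
    unfolding grid_inner_def by (intro sum.cong) (auto simp: inner_diff_right)
  then show ?thesis
    by (simp add: sum_subtractf)
qed

definition staggered_sbp ::
  "real \<Rightarrow> real \<Rightarrow> nat \<Rightarrow> (nat \<Rightarrow> nat \<Rightarrow> real) \<Rightarrow> (nat \<Rightarrow> nat \<Rightarrow> real) \<Rightarrow>
   (nat \<Rightarrow> nat \<Rightarrow> real) \<Rightarrow> (nat \<Rightarrow> nat \<Rightarrow> real) \<Rightarrow> bool" where
  "staggered_sbp xL xR N Po Pe Qo Qe \<longleftrightarrow>
     (\<exists>s. sbp_accurate s (N + 1) (even_node xL xR N) N (odd_node xL xR N) (sbp_diff Po Qo) \<and>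
          sbp_accurate s N (odd_node xL xR N) (N + 1) (even_node xL xR N) (sbp_diff Pe Qe)) \<and>
     (\<forall>i\<le>N. \<forall>j\<le>N + 1. Qo i j + Qe j i = boundary_matrix N i j) \<and>
     diag_pos_def N Po \<and> diag_pos_def (N + 1) Pe"

definition sat_term ::
  "nat \<Rightarrow> (nat \<Rightarrow> nat \<Rightarrow> real) \<Rightarrow> real^'o^'a \<Rightarrow> real^'o^'a \<Rightarrow> real^'o \<Rightarrow> real^'o \<Rightarrow> nat \<Rightarrow> real^'a" where
  "sat_term n P \<tau>0 \<tau>N r0 rN i =
     (if i = 0 then inverse (P 0 0) *\<^sub>R (\<tau>0 *v r0)
      else if i = n then inverse (P n n) *\<^sub>R (\<tau>N *v rN)
      else 0)"

definition semidiscrete_solution ::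
  "nat \<Rightarrow> (nat \<Rightarrow> nat \<Rightarrow> real) \<Rightarrow> (nat \<Rightarrow> nat \<Rightarrow> real) \<Rightarrow> (nat \<Rightarrow> nat \<Rightarrow> real) \<Rightarrow> (nat \<Rightarrow> nat \<Rightarrow> real) \<Rightarrow>
   real^'e^'o \<Rightarrow> real^'o^'o \<Rightarrow> real^'o^'o \<Rightarrow> real^'o^'o \<Rightarrow> real^'o^'e \<Rightarrow> real^'o^'e \<Rightarrow>
   real \<Rightarrow> (real \<Rightarrow> real^'o) \<Rightarrow> (real \<Rightarrow> real^'o) \<Rightarrow> (nat \<Rightarrow> real^'o) \<Rightarrow> (nat \<Rightarrow> real^'e) \<Rightarrow>
   (real \<Rightarrow> nat \<Rightarrow> real^'o) \<Rightarrow> (real \<Rightarrow> nat \<Rightarrow> real^'e) \<Rightarrow> bool" where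
  "semidiscrete_solution N Po Pe Qo Qe A L \<tau>o0 \<tau>oN \<tau>e0 \<tau>eN T gL gR uo0 ue0 uo ue \<longleftrightarrow>
     (\<forall>i\<le>N. uo 0 i = uo0 i) \<and> (\<forall>i\<le>N + 1. ue 0 i = ue0 i) \<and>
     (\<forall>t\<in>{0..T}.
        let r0 = uo t 0 + L *v (A *v ue t 0) - gL t;
            rN = uo t N - L *v (A *v ue t (N + 1)) - gR t
        in (\<forall>i\<le>N. ((\<lambda>t. uo t i) has_vector_derivative
                     sat_term N Po \<tau>o0 \<tau>oN r0 rN i
                     - grid_apply (N + 1) (sbp_diff Po Qo) (\<lambda>j. A *v ue t j) i)
                   (at t within {0..T})) \<and>
           (\<forall>i\<le>N + 1. ((\<lambda>t. ue t i) has_vector_derivative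
                     sat_term (N + 1) Pe \<tau>e0 \<tau>eN r0 rN i
                     - grid_apply N (sbp_diff Pe Qe) (\<lambda>j. transpose A *v uo t j) i)
                   (at t within {0..T})))"

text \<open>Boundary sources are square integrable on \<open>(0,T)\<close> and take their values in the image of
  \<open>L\<close>.\<close>

definition boundary_source :: "real^'o^'o \<Rightarrow> real \<Rightarrow> (real \<Rightarrow> real^'o) \<Rightarrow> bool" where
  "boundary_source L T g \<longleftrightarrow>
     g \<in> borel_measurable (lebesgue_on {0..T}) \<and>
     (\<lambda>t. g t \<bullet> g t) absolutely_integrable_on {0..T} \<and>
     (\<forall>t\<in>{0..T}. g t \<in> range ((*v) L))"

definition energy_bound ::
  "nat \<Rightarrow> (nat \<Rightarrow> nat \<Rightarrow> real) \<Rightarrow> (nat \<Rightarrow> nat \<Rightarrow> real) \<Rightarrow> (nat \<Rightarrow> nat \<Rightarrow> real) \<Rightarrow> (nat \<Rightarrow> nat \<Rightarrow> real) \<Rightarrow>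
   real^'e^'o \<Rightarrow> real^'o^'o \<Rightarrow> real^'o^'o \<Rightarrow> real^'o^'o \<Rightarrow> real^'o^'e \<Rightarrow> real^'o^'e \<Rightarrow> real \<Rightarrow> bool" where
  "energy_bound N Po Pe Qo Qe A L \<tau>o0 \<tau>oN \<tau>e0 \<tau>eN C \<longleftrightarrow>
     (\<forall>T>0. \<forall>gL gR uo0 ue0 uo ue.
        boundary_source L T gL \<longrightarrow> boundary_source L T gR \<longrightarrow>
        semidiscrete_solution N Po Pe Qo Qe A L \<tau>o0 \<tau>oN \<tau>e0 \<tau>eN T gL gR uo0 ue0 uo ue \<longrightarrow>
        grid_norm_sq N Po (uo T) + grid_norm_sq (N + 1) Pe (ue T)
          \<le> grid_norm_sq N Po uo0 + grid_norm_sq (N + 1) Pe ue0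
             + C * (integral {0..T} (\<lambda>t. gL t \<bullet> gL t) + integral {0..T} (\<lambda>t. gR t \<bullet> gR t)))"

definition pos_semidefinite :: "real^'n^'n \<Rightarrow> bool" where
  "pos_semidefinite M \<longleftrightarrow> (\<forall>x. x \<bullet> (M *v x) \<ge> 0)"

definition neg_semidefinite :: "real^'n^'n \<Rightarrow> bool" where
  "neg_semidefinite M \<longleftrightarrow> (\<forall>x. x \<bullet> (M *v x) \<le> 0)"

definition is_pseudo_inverse :: "real^'n^'m \<Rightarrow> real^'m^'n \<Rightarrow> bool" where
  "is_pseudo_inverse M X \<longleftrightarrow>
     M ** X ** M = M \<and> X ** M ** X = X \<and>
     transpose (M ** X) = M ** X \<and> transpose (X ** M) = X ** M"

end

theory Submission
  imports Defs
begin

text \<open>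
  By the SBP property the energy rate of a solution is the sum of one boundary term per end, and
  the choice of the even penalties makes it a quadratic form in the boundary traces and the
  source.  Completing squares bounds this form under the condition when the penalties are
  symmetric.  Conversely, without sources the bound forces the rate at \<open>t = 0\<close> to be nonpositive
  for all initial data, since the semi-discrete system is solvable; the traces at the two
  ends can be prescribed independently because \<open>A\<close> is surjective, and the data
  \<open>(w, v) = (x, 0)\<close> and \<open>(0, x)\<close> give the two parts of the condition.
\<close>

section \<open>Diagonal norms and summation by parts\<close>

lemma diag_pos_def_entry_pos:
  assumes "diag_pos_def n P" "i \<le> n"
  shows "P i i > 0"
proof -
  let ?x = "\<lambda>k. if k = i then 1 else 0 :: real"
  have "grid_inner n ?x (grid_apply n P ?x) = P i i"
    using assms(2) by (simp add: grid_inner_def grid_apply_def if_distrib[of "\<lambda>x. _ * x"] 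
      if_distrib[of "\<lambda>x. x * _"] cong: if_cong)
  moreover have "grid_inner n ?x (grid_apply n P ?x) > 0"
    using assms unfolding diag_pos_def_def by auto
  ultimately show ?thesis by simp
qed

lemma grid_norm_sq_diag:
  assumes "diag_pos_def n P"
  shows "grid_norm_sq n P f = (\<Sum>i\<le>n. P i i * (f i \<bullet> f i))"
  unfolding grid_norm_sq_def grid_inner_def
proof (rule sum.cong)
  fix i assume i: "i \<in> {..n}"
  have "grid_apply n P f i = (\<Sum>j\<le>n. if j = i then P i i *\<^sub>R f i else 0)"
    unfolding grid_apply_def using assms i by (intro sum.cong) (auto simp: diag_pos_def_def)
  then show "f i \<bullet> grid_apply n P f i = P i i * (f i \<bullet> f i)"
    using i by simp
qed simp

text \<open>Discrete integration by parts: after swapping the order of summation in the second sum,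
  the products \<open>f i \<bullet> g j\<close> carry the coefficient
  \<open>Qo i j + Qe j i\<close>, an entry of the boundary matrix.\<close>

lemma sbp_pairing:
  fixes f g :: "nat \<Rightarrow> 'v::real_inner"
  assumes "\<forall>i\<le>N. \<forall>j\<le>N + 1. Qo i j + Qe j i = boundary_matrix N i j"
  shows "(\<Sum>i\<le>N. f i \<bullet> grid_apply (N + 1) Qo g i) + (\<Sum>j\<le>N + 1. g j \<bullet> grid_apply N Qe f j)
         = f N \<bullet> g (N + 1) - f 0 \<bullet> g 0"
proof -
  have "(\<Sum>j\<le>N + 1. g j \<bullet> grid_apply N Qe f j) = (\<Sum>j\<le>N + 1. \<Sum>i\<le>N. Qe j i * (f i \<bullet> g j))"
    by (simp add: grid_apply_def inner_sum_right inner_commute del: sum.atMost_Suc)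
  also have "\<dots> = (\<Sum>i\<le>N. \<Sum>j\<le>N + 1. Qe j i * (f i \<bullet> g j))"
    by (rule sum.swap)
  finally have "(\<Sum>i\<le>N. f i \<bullet> grid_apply (N + 1) Qo g i) + (\<Sum>j\<le>N + 1. g j \<bullet> grid_apply N Qe f j)
      = (\<Sum>i\<le>N. \<Sum>j\<le>N + 1. (Qo i j + Qe j i) * (f i \<bullet> g j))"
    by (simp add: grid_apply_def inner_sum_right sum.distrib distrib_right del: sum.atMost_Suc)
  also have "\<dots> = (\<Sum>i\<le>N. \<Sum>j\<le>N + 1. boundary_matrix N i j * (f i \<bullet> g j))"
    using assms by (intro sum.cong refl) auto
  also have "\<dots> = grid_inner N f (grid_apply (N + 1) (boundary_matrix N) g)"
    by (simp add: grid_inner_def grid_apply_def inner_sum_right del: sum.atMost_Suc)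
  finally show ?thesis
    by (simp only: grid_inner_boundary_matrix)
qed

section \<open>Energy balance reduced to boundary terms\<close>

lemma grid_apply_matrix_vector_mult:
  "grid_apply n M (\<lambda>j. B *v f j) i = B *v grid_apply n M f i"
  for B :: "real^'m^'k"
  by (simp add: grid_apply_def linear_sum[OF matrix_vector_mul_linear] matrix_vector_mult_scaleR
      del: sum.atMost_Suc)

lemma inner_matrix_vector_transpose: "(x::real^'m) \<bullet> (transpose B *v y) = (B *v x) \<bullet> y"
  for B :: "real^'m^'k"
  by (metis dot_lmul_matrix inner_commute matrix_transpose_mul transpose_matrix_vector)

lemma matrix_vector_mult_uminus: "(- M) *v x = - (M *v x)" "M *v (- x) = - (M *v x)"
  for M :: "real^'n^'m"
  by (simp_all add: vec_eq_iff matrix_vector_mult_def sum_negf)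

text \<open>The norm weights cancel the inverses in the penalty terms; \<open>n > 0\<close> keeps
  the two boundary nodes distinct.\<close>

lemma sat_term_sum:
  fixes f :: "nat \<Rightarrow> real^'a" and \<tau>0 \<tau>N :: "real^'o^'a"
  assumes "diag_pos_def n P" "n > 0"
  shows "(\<Sum>i\<le>n. P i i * (f i \<bullet> sat_term n P \<tau>0 \<tau>N r0 rN i)) = f 0 \<bullet> (\<tau>0 *v r0) + f n \<bullet> (\<tau>N *v rN)"
proof -
  have "P 0 0 > 0" "P n n > 0"
    using diag_pos_def_entry_pos[OF assms(1)] by auto
  then have "P i i * (f i \<bullet> sat_term n P \<tau>0 \<tau>N r0 rN i) =
      (if i = 0 then f 0 \<bullet> (\<tau>0 *v r0) else 0) + (if i = n then f n \<bullet> (\<tau>N *v rN) else 0)" for i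
    using assms(2) by (auto simp: sat_term_def)
  then show ?thesis
    by (simp add: sum.distrib)
qed

lemma sbp_diff_sum:
  fixes f :: "nat \<Rightarrow> 'v::real_inner"
  assumes "diag_pos_def n P"
  shows "(\<Sum>i\<le>n. P i i * (f i \<bullet> grid_apply m (sbp_diff P Q) g i)) = (\<Sum>i\<le>n. f i \<bullet> grid_apply m Q g i)"
proof (rule sum.cong)
  fix i assume "i \<in> {..n}"
  then have "P i i \<noteq> 0"
    using diag_pos_def_entry_pos[OF assms, of i] by auto
  then show "P i i * (f i \<bullet> grid_apply m (sbp_diff P Q) g i) = f i \<bullet> grid_apply m Q g i"
    by (simp add: grid_apply_def sbp_diff_def inner_sum_right sum_distrib_left del: sum.atMost_Suc)
qed simp

text \<open>Half the energy production at the left end for trace values \<open>w = u\<^sup>o\<close>, \<open>v = A u\<^sup>e\<close>; the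
  right end has the same form with \<open>v = - A u\<^sup>e\<close>.\<close>

definition boundary_rate :: "real^'o^'o \<Rightarrow> real^'o^'o \<Rightarrow> real^'o \<Rightarrow> real^'o \<Rightarrow> real^'o \<Rightarrow> real" where
  "boundary_rate L \<tau> g w v =
     (let r = w + L *v v - g in w \<bullet> v + w \<bullet> (\<tau> *v r) - (v + \<tau> *v (L *v v)) \<bullet> r)"

text \<open>Pairing the right-hand side with the state in the two norms turns
  \<open>sbp_diff\<close> into \<open>Qo\<close> and \<open>Qe\<close>. Once \<open>A\<close> has
  been moved across the inner product, both sums involve only \<open>w\<close> and
  \<open>A *v v\<close>, so \<open>sbp_pairing\<close> leaves boundary traces.\<close>

lemma energy_rate:
  fixes A :: "real^'e^'o" and L \<tau>o0 \<tau>oN :: "real^'o^'o"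
  assumes sbp: "staggered_sbp xL xR N Po Pe Qo Qe" and "N \<ge> 1"
    and \<tau>e: "\<tau>e0 = - transpose (A + \<tau>o0 ** L ** A)" "\<tau>eN = transpose (A + \<tau>oN ** L ** A)"
    and r: "r0 = w 0 + L *v (A *v v 0) - gL" "rN = w N - L *v (A *v v (N + 1)) - gR"
  shows "(\<Sum>i\<le>N. Po i i * (w i \<bullet> (sat_term N Po \<tau>o0 \<tau>oN r0 rN i
              - grid_apply (N + 1) (sbp_diff Po Qo) (\<lambda>j. A *v v j) i)))
       + (\<Sum>i\<le>N + 1. Pe i i * (v i \<bullet> (sat_term (N + 1) Pe \<tau>e0 \<tau>eN r0 rN i
              - grid_apply N (sbp_diff Pe Qe) (\<lambda>j. transpose A *v w j) i)))
       = boundary_rate L \<tau>o0 gL (w 0) (A *v v 0) + boundary_rate L \<tau>oN gR (w N) (- (A *v v (N + 1)))"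
proof -
  have P: "diag_pos_def N Po" "diag_pos_def (N + 1) Pe"
    and Q: "\<forall>i\<le>N. \<forall>j\<le>N + 1. Qo i j + Qe j i = boundary_matrix N i j"
    using sbp by (auto simp: staggered_sbp_def)
  \<comment> \<open>The prescribed even penalty makes this term depend on \<open>v 0\<close> only
    through \<open>A *v v 0\<close>, as \<open>boundary_rate\<close> requires.\<close>
  have e0: "v 0 \<bullet> (\<tau>e0 *v r0) = - ((A *v v 0 + \<tau>o0 *v (L *v (A *v v 0))) \<bullet> r0)"
  proof -
    have "\<tau>e0 *v r0 = - (transpose (A + \<tau>o0 ** L ** A) *v r0)"
      using \<tau>e(1) by (simp add: matrix_vector_mult_uminus)
    then show ?thesis
      by (simp only: inner_minus_right inner_matrix_vector_transpose
          matrix_vector_mult_add_rdistrib matrix_vector_mul_assoc[symmetric])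
  qed
  have eN: "v (N + 1) \<bullet> (\<tau>eN *v rN)
      = (A *v v (N + 1) + \<tau>oN *v (L *v (A *v v (N + 1)))) \<bullet> rN"
    unfolding \<tau>e(2) by (simp only: inner_matrix_vector_transpose
          matrix_vector_mult_add_rdistrib matrix_vector_mul_assoc[symmetric])
  have "(\<Sum>i\<le>N + 1. v i \<bullet> grid_apply N Qe (\<lambda>j. transpose A *v w j) i)
      = (\<Sum>i\<le>N + 1. (A *v v i) \<bullet> grid_apply N Qe w i)"
    by (simp only: grid_apply_matrix_vector_mult inner_matrix_vector_transpose)
  with sbp_pairing[OF Q, of w "\<lambda>i. A *v v i"]
  have pair: "(\<Sum>i\<le>N. w i \<bullet> grid_apply (N + 1) Qo (\<lambda>j. A *v v j) i)
      + (\<Sum>i\<le>N + 1. v i \<bullet> grid_apply N Qe (\<lambda>j. transpose A *v w j) i)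
      = w N \<bullet> (A *v v (N + 1)) - w 0 \<bullet> (A *v v 0)"
    by simp
  show ?thesis
    unfolding inner_diff_right right_diff_distrib sum_subtractf
      sbp_diff_sum[OF P(1)] sbp_diff_sum[OF P(2)]
    using sat_term_sum[OF P(1), of w \<tau>o0 \<tau>oN r0 rN] sat_term_sum[OF P(2), of v \<tau>e0 \<tau>eN r0 rN]
      pair e0 eN assms(2)
    by (simp add: boundary_rate_def Let_def r matrix_vector_mult_uminus inner_diff_left inner_add_left
        del: sum.atMost_Suc)
qed

lemma energy_has_derivative:
  fixes A :: "real^'e^'o" and L \<tau>o0 \<tau>oN :: "real^'o^'o"
  assumes sbp: "staggered_sbp xL xR N Po Pe Qo Qe" and "N \<ge> 1"
    and \<tau>e: "\<tau>e0 = - transpose (A + \<tau>o0 ** L ** A)" "\<tau>eN = transpose (A + \<tau>oN ** L ** A)"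
    and sol: "semidiscrete_solution N Po Pe Qo Qe A L \<tau>o0 \<tau>oN \<tau>e0 \<tau>eN T gL gR uo0 ue0 uo ue"
    and t: "t \<in> {0..T}"
  shows "((\<lambda>t. grid_norm_sq N Po (uo t) + grid_norm_sq (N + 1) Pe (ue t)) has_real_derivative
      2 * (boundary_rate L \<tau>o0 (gL t) (uo t 0) (A *v ue t 0)
         + boundary_rate L \<tau>oN (gR t) (uo t N) (- (A *v ue t (N + 1))))) (at t within {0..T})"
proof -
  have P: "diag_pos_def N Po" "diag_pos_def (N + 1) Pe"
    using sbp by (auto simp: staggered_sbp_def)
  define r0 where "r0 = uo t 0 + L *v (A *v ue t 0) - gL t"
  define rN where "rN = uo t N - L *v (A *v ue t (N + 1)) - gR t"
  let ?do = "\<lambda>i. sat_term N Po \<tau>o0 \<tau>oN r0 rN i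
              - grid_apply (N + 1) (sbp_diff Po Qo) (\<lambda>j. A *v ue t j) i"
  let ?de = "\<lambda>i. sat_term (N + 1) Pe \<tau>e0 \<tau>eN r0 rN i
              - grid_apply N (sbp_diff Pe Qe) (\<lambda>j. transpose A *v uo t j) i"
  have d: "((\<lambda>t. uo t i) has_vector_derivative ?do i) (at t within {0..T})" if "i \<le> N" for i
    using sol t that by (auto simp: semidiscrete_solution_def Let_def r0_def rN_def)
  have d': "((\<lambda>t. ue t i) has_vector_derivative ?de i) (at t within {0..T})" if "i \<le> N + 1" for i
    using sol t that by (auto simp: semidiscrete_solution_def Let_def r0_def rN_def)
  have sq: "((\<lambda>t. f t \<bullet> f t) has_real_derivative 2 * (f t \<bullet> f')) (at t within {0..T})"
    if "(f has_vector_derivative f') (at t within {0..T})" for f :: "real \<Rightarrow> 'v::real_inner" and f'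
    using bounded_bilinear.has_vector_derivative[OF bounded_bilinear_inner that that]
    by (simp add: has_real_derivative_iff_has_vector_derivative inner_commute)
  have "((\<lambda>t. (\<Sum>i\<le>N. Po i i * (uo t i \<bullet> uo t i)) + (\<Sum>i\<le>N + 1. Pe i i * (ue t i \<bullet> ue t i)))
      has_real_derivative (\<Sum>i\<le>N. Po i i * (2 * (uo t i \<bullet> ?do i)))
        + (\<Sum>i\<le>N + 1. Pe i i * (2 * (ue t i \<bullet> ?de i)))) (at t within {0..T})"
    by (intro DERIV_add DERIV_sum DERIV_cmult sq d d') auto
  moreover have "(\<Sum>i\<le>N. Po i i * (2 * (uo t i \<bullet> ?do i))) + (\<Sum>i\<le>N + 1. Pe i i * (2 * (ue t i \<bullet> ?de i)))
    = 2 * ((\<Sum>i\<le>N. Po i i * (uo t i \<bullet> ?do i)) + (\<Sum>i\<le>N + 1. Pe i i * (ue t i \<bullet> ?de i)))"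
    by (simp add: sum_distrib_left distrib_left mult.left_commute del: sum.atMost_Suc)
  ultimately show ?thesis
    using energy_rate[OF sbp assms(2) \<tau>e r0_def rN_def]
    by (simp only: grid_norm_sq_diag[OF P(1)] grid_norm_sq_diag[OF P(2)])
qed

section \<open>Bound on the boundary rate for symmetric penalties\<close>

lemma inner_symmetric_matrix:
  fixes M :: "real^'n^'n"
  assumes "transpose M = M"
  shows "x \<bullet> (M *v y) = y \<bullet> (M *v x)"
  by (metis assms inner_commute inner_matrix_vector_transpose)

text \<open>Moving \<open>L\<close> and then \<open>transpose (- \<tau>)\<close> across the inner
  product shows that the form in the condition is the one of \<open>- \<tau>\<close> at
  \<open>L *v x\<close>.\<close>

lemma inner_conjugated_transpose_uminus:
  fixes L \<tau> :: "real^'n^'n"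
  assumes "transpose L = L"
  shows "x \<bullet> ((L ** transpose (- \<tau>) ** L) *v x) = - ((L *v x) \<bullet> (\<tau> *v (L *v x)))"
proof -
  have "x \<bullet> ((L ** transpose (- \<tau>) ** L) *v x) = x \<bullet> (transpose L *v (transpose (- \<tau>) *v (L *v x)))"
    using assms by (simp only: matrix_vector_mul_assoc[symmetric])
  then show ?thesis
    by (simp only: inner_matrix_vector_transpose)
      (simp add: matrix_vector_mult_uminus inner_commute)
qed

text \<open>Writing \<open>g = L h\<close> and \<open>\<sigma> = - \<tau>\<close>, the rate is
  \<open>- |r - L v + g/2|\<^sup>2\<^sub>\<sigma> - (|v - h/2|\<^sup>2\<^sub>L - |L (v - h/2)|\<^sup>2\<^sub>\<sigma>) + |h|\<^sup>2\<^sub>L / 4\<close>,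
  and \<open>|h|\<^sup>2\<^sub>L = g \<bullet> L\<^sup>+ g\<close>.\<close>

lemma boundary_rate_le:
  fixes L Lp \<tau> :: "real^'o^'o"
  assumes sym: "transpose L = L" "transpose \<tau> = \<tau>"
    and pinv: "is_pseudo_inverse L Lp"
    and neg: "neg_semidefinite \<tau>"
    and cond: "\<forall>x. x \<bullet> ((L ** transpose (- \<tau>) ** L) *v x) \<le> x \<bullet> (L *v x)"
    and C: "onorm ((*v) \<tau>) \<le> C" "onorm ((*v) (Lp + transpose \<tau>)) \<le> C"
    and g: "g \<in> range ((*v) L)"
  shows "2 * boundary_rate L \<tau> g w v \<le> C * (g \<bullet> g)"
proof -
  obtain h where h: "g = L *v h" using g by auto
  define r where "r = w + L *v v - g"
  \<comment> \<open>By the definition of \<open>r\<close>, this is \<open>w - g/2\<close>;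
    \<open>x\<close> shifts \<open>v\<close> by half of \<open>h\<close> in the same way.\<close>
  define p where "p = r - L *v v + (1/2) *\<^sub>R g"
  define x where "x = v - (1/2) *\<^sub>R h"
  have cond': "- ((L *v x) \<bullet> (\<tau> *v (L *v x))) \<le> x \<bullet> (L *v x)"
    using cond[rule_format, of x] by (simp add: inner_conjugated_transpose_uminus[OF sym(1)])
  have pneg: "p \<bullet> (\<tau> *v p) \<le> 0"
    using neg by (auto simp: neg_semidefinite_def)
  have w: "w = r - L *v v + g" by (simp add: r_def)
  have "boundary_rate L \<tau> g w v = w \<bullet> v + w \<bullet> (\<tau> *v r) - (v + \<tau> *v (L *v v)) \<bullet> r"
    by (simp add: boundary_rate_def Let_def r_def)
  \<comment> \<open>Symmetry of \<open>\<tau>\<close> merges the mixed terms in \<open>r\<close>,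
    \<open>L *v v\<close> and \<open>L *v h\<close>; the terms with \<open>\<tau>\<close> become a
    difference of two squares, the others a completed square in \<open>L\<close>.\<close>
  also have "\<dots> = p \<bullet> (\<tau> *v p) - (x \<bullet> (L *v x) + (L *v x) \<bullet> (\<tau> *v (L *v x))) + h \<bullet> (L *v h) / 4"
    using inner_symmetric_matrix[OF sym(1), of v h]
      inner_symmetric_matrix[OF sym(2), of r "L *v v"]
      inner_symmetric_matrix[OF sym(2), of r "L *v h"]
      inner_symmetric_matrix[OF sym(2), of "L *v v" "L *v h"]
    unfolding w p_def x_def h
    by (simp add: matrix_vector_mult_diff_distrib matrix_vector_right_distrib
        matrix_vector_mult_scaleR inner_diff_left inner_diff_right inner_add_left inner_add_right
        inner_commute field_simps)
  finally have "boundary_rate L \<tau> g w v \<le> h \<bullet> (L *v h) / 4"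
    using cond' pneg by linarith
  \<comment> \<open>The factor 2 suffices: \<open>2 * boundary_rate L \<tau> g w v\<close> is at
    most half of this form.\<close>
  moreover have "h \<bullet> (L *v h) \<le> 2 * C * (g \<bullet> g)"
  proof -
    have bnd: "\<bar>g \<bullet> (M *v g)\<bar> \<le> C * (g \<bullet> g)" if "onorm ((*v) M) \<le> C" for M :: "real^'o^'o"
    proof -
      have "\<bar>g \<bullet> (M *v g)\<bar> \<le> norm g * norm (M *v g)"
        by (rule Cauchy_Schwarz_ineq2)
      also have "\<dots> \<le> norm g * (onorm ((*v) M) * norm g)"
        by (intro mult_left_mono onorm matrix_vector_mul_bounded_linear) auto
      also have "\<dots> \<le> norm g * (C * norm g)"
        by (intro mult_left_mono mult_right_mono that) auto
      finally show ?thesis by (simp add: dot_square_norm power2_eq_square ac_simps)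
    qed
    have "L *v h = L *v (Lp *v (L *v h))"
      using pinv by (simp add: is_pseudo_inverse_def matrix_vector_mul_assoc matrix_mul_assoc)
    then have "h \<bullet> (L *v h) = g \<bullet> (Lp *v g)"
      using inner_symmetric_matrix[OF sym(1), of h "Lp *v g"] by (simp add: h inner_commute)
    \<comment> \<open>This splitting of \<open>Lp\<close> explains the two kinds of norms in the
      constant: each piece is at most \<open>C * (g \<bullet> g)\<close> in absolute value.\<close>
    also have "\<dots> = g \<bullet> ((Lp + transpose \<tau>) *v g) - g \<bullet> (\<tau> *v g)"
      by (simp add: sym(2) matrix_vector_mult_add_rdistrib inner_add_right)
    also have "\<dots> \<le> 2 * C * (g \<bullet> g)"
      using bnd[OF C(1)] bnd[OF C(2)] by linarith
    finally show ?thesis .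
  qed
  ultimately show ?thesis by linarith
qed

section \<open>Solvability of the system without sources\<close>

text \<open>The exponential series of the system matrix, applied to \<open>y0\<close>, is a
  solution: the powers applied to \<open>y0\<close> grow at most geometrically, so the series
  converges for all \<open>t\<close> and can be differentiated term by term.\<close>

lemma linear_grid_ode_exists:
  fixes K :: "nat \<Rightarrow> nat \<Rightarrow> 'v::euclidean_space \<Rightarrow> 'v"
  assumes K: "\<And>i j. bounded_linear (K i j)"
  shows "\<exists>y. (\<forall>i. y 0 i = y0 i) \<and>
    (\<forall>t. \<forall>i\<le>n. ((\<lambda>t. y t i) has_vector_derivative (\<Sum>j\<le>n. K i j (y t j))) (at t))"
proof -
  \<comment> \<open>\<open>c k\<close> is the \<open>k\<close>-th power of the system matrix applied to \<open>y0\<close>.\<close>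
  define c where "c = rec_nat y0 (\<lambda>k f i. \<Sum>j\<le>n. K i j (f j))"
  have c0: "c 0 = y0" and cS: "c (Suc k) i = (\<Sum>j\<le>n. K i j (c k j))" for k i
    by (simp_all add: c_def)
  \<comment> \<open>\<open>B\<close> bounds the system matrix with respect to the sum norm measured
    by \<open>S\<close>.\<close>
  define B where "B = (\<Sum>i\<le>n. \<Sum>j\<le>n. onorm (K i j))"
  define S where "S k = (\<Sum>i\<le>n. norm (c k i))" for k
  have on: "onorm (K i j) \<ge> 0" for i j
    by (rule onorm_pos_le[OF K])
  have B0: "B \<ge> 0"
    unfolding B_def by (intro sum_nonneg on)
  have cS_le: "norm (c k i) \<le> S k" if "i \<le> n" for k i
    unfolding S_def using that by (intro member_le_sum) auto
  have "S (Suc k) \<le> B * S k" for k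
  proof -
    have "S (Suc k) \<le> (\<Sum>i\<le>n. \<Sum>j\<le>n. onorm (K i j) * S k)"
      unfolding S_def[of "Suc k"] cS
    proof (intro sum_mono order.trans[OF norm_sum])
      fix i j assume "j \<in> {..n}"
      then show "norm (K i j (c k j)) \<le> onorm (K i j) * S k"
        by (intro order.trans[OF onorm[OF K]] mult_left_mono cS_le on) auto
    qed
    then show ?thesis
      by (simp add: B_def sum_distrib_right)
  qed
  then have "S k \<le> B ^ k * S 0" for k
  proof (induction k)
    case (Suc k)
    have "S (Suc k) \<le> B * S k" by (rule Suc.prems)
    also have "\<dots> \<le> B * (B ^ k * S 0)"
      by (intro mult_left_mono Suc.IH Suc.prems B0)
    finally show ?case by simp
  qed simp
  then have c_bound: "norm (c k i) \<le> B ^ k * S 0" if "i \<le> n" for k i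
    using cS_le[OF that, of k] by (meson order.trans)
  have summ: "summable (\<lambda>k. (t ^ k / fact k) *\<^sub>R c k i)" if "i \<le> n" for t i
  proof (rule summable_comparison_test')
    show "summable (\<lambda>k. S 0 * (inverse (fact k) * (\<bar>t\<bar> * B) ^ k))"
      by (intro summable_mult summable_exp)
    show "norm ((t ^ k / fact k) *\<^sub>R c k i) \<le> S 0 * (inverse (fact k) * (\<bar>t\<bar> * B) ^ k)"
      if "k \<ge> 0" for k
    proof -
      have "norm ((t ^ k / fact k) *\<^sub>R c k i) = \<bar>t\<bar> ^ k / fact k * norm (c k i)"
        by (simp add: power_abs)
      also have "\<dots> \<le> \<bar>t\<bar> ^ k / fact k * (B ^ k * S 0)"
        by (intro mult_left_mono c_bound \<open>i \<le> n\<close>) auto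
      finally show ?thesis
        by (simp add: power_mult_distrib field_simps)
    qed
  qed
  \<comment> \<open>Beyond \<open>n\<close> the value is frozen, since the initial condition is
    claimed for every index.\<close>
  define y where "y t i = (if i \<le> n then (\<Sum>k. (t ^ k / fact k) *\<^sub>R c k i) else y0 i)" for t i
  have "y 0 i = y0 i" for i
  proof (cases "i \<le> n")
    case True
    have "(\<lambda>k. (0 ^ k / fact k) *\<^sub>R c k i) = (\<lambda>k. if k = 0 then y0 i else 0)"
      by (auto simp: c0)
    then show ?thesis
      using True sums_single[of 0 "\<lambda>_. y0 i"] by (simp add: y_def sums_iff)
  qed (simp add: y_def)
  moreover have "((\<lambda>t. y t i) has_vector_derivative (\<Sum>j\<le>n. K i j (y t j))) (at t)"
    if i: "i \<le> n" for t i
  proof -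
    \<comment> \<open>Pairing with a fixed \<open>b\<close> gives a real power series; letting
      \<open>b\<close> run through the basis recovers the vector derivative.\<close>
    have "((\<lambda>t. y t i \<bullet> b) has_real_derivative (\<Sum>j\<le>n. K i j (y t j)) \<bullet> b) (at t)" for b
    proof -
      define a where "a k = (c k i \<bullet> b) / fact k" for k
      have "(\<lambda>k. (x ^ k / fact k) *\<^sub>R c k i \<bullet> b) = (\<lambda>k. a k * x ^ k)" for x
        by (simp add: a_def mult.commute)
      then have asum: "summable (\<lambda>k. a k * x ^ k)" and ay: "y x i \<bullet> b = (\<Sum>k. a k * x ^ k)" for x
        using bounded_linear.summable[OF bounded_linear_inner_left[of b] summ[OF i, of x]]
          bounded_linear.suminf[OF bounded_linear_inner_left[of b] summ[OF i, of x]] i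
        by (simp_all add: y_def)
      have "((\<lambda>x. \<Sum>k. a k * x ^ k) has_real_derivative (\<Sum>k. diffs a k * t ^ k)) (at t)"
        by (rule termdiffs_strong_converges_everywhere) (rule asum)
      moreover have "(\<Sum>k. diffs a k * t ^ k) = (\<Sum>j\<le>n. K i j (y t j)) \<bullet> b"
      proof -
        \<comment> \<open>\<open>diffs\<close> shifts the index by one, and the recursion for
          \<open>c (Suc k)\<close> supplies one more application of the system matrix.\<close>
        have "diffs a k * t ^ k = (\<Sum>j\<le>n. K i j ((t ^ k / fact k) *\<^sub>R c k j) \<bullet> b)" for k
        proof -
          have "diffs a k * t ^ k = (c (Suc k) i \<bullet> b) * (t ^ k / fact k)"
            by (simp add: diffs_def a_def del: of_nat_Suc)
          also have "\<dots> = (\<Sum>j\<le>n. (t ^ k / fact k) * (K i j (c k j) \<bullet> b))"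
            by (simp add: cS inner_sum_left sum_distrib_right sum_distrib_left mult.commute)
          finally show ?thesis
            by (simp add: linear_cmul[OF bounded_linear.linear[OF K]])
        qed
        moreover have "(\<lambda>k. K i j ((t ^ k / fact k) *\<^sub>R c k j) \<bullet> b) sums (K i j (y t j) \<bullet> b)"
          if "j \<le> n" for j
          using bounded_linear.sums[OF bounded_linear_compose[OF bounded_linear_inner_left K]
              summable_sums[OF summ[OF that]]] that
          by (simp add: y_def)
        then have "(\<lambda>k. \<Sum>j\<le>n. K i j ((t ^ k / fact k) *\<^sub>R c k j) \<bullet> b)
            sums (\<Sum>j\<le>n. K i j (y t j) \<bullet> b)"
          by (intro sums_sum) auto
        ultimately show ?thesis
          by (simp add: sums_iff inner_sum_left)
      qed
      ultimately show ?thesis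
        by (simp add: ay)
    qed
    then show ?thesis
      unfolding has_real_derivative_iff_has_vector_derivative has_vector_derivative_def
      by (subst has_derivative_componentwise_within) simp
  qed
  ultimately show ?thesis by blast
qed

lemma linear_sat_term:
  assumes "linear f" "linear g"
  shows "linear (\<lambda>p. sat_term n P \<tau>0 \<tau>N (f p) (g p) i)"
proof -
  have "linear (\<lambda>p. c *\<^sub>R (M *v h p))" if "linear h" for c and M :: "real^'k^'m" and h :: "'p::real_vector \<Rightarrow> _"
    using linear_compose[OF that matrix_vector_mul_linear[of M]]
    by (intro linear_compose_scale_right) (simp add: o_def)
  then show ?thesis
    using assms by (cases "i = 0"; cases "i = n") (auto simp: sat_term_def linear_zero)
qed

text \<open>The penalty is linear in the residuals, so it splits into contributions of single nodes,
  the form that \<open>linear_grid_ode_exists\<close> works with.\<close>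

lemma sat_term_sum_residual:
  fixes f g :: "'k \<Rightarrow> real^'o"
  shows "sat_term n P \<tau>0 \<tau>N (\<Sum>j\<in>J. f j) (\<Sum>j\<in>J. g j) i = (\<Sum>j\<in>J. sat_term n P \<tau>0 \<tau>N (f j) (g j) i)"
  by (simp add: sat_term_def linear_sum[OF matrix_vector_mul_linear] scaleR_sum_right)

text \<open>Odd and even values with the same index are paired into one grid function on
  \<open>0..N + 1\<close>, to which \<open>linear_grid_ode_exists\<close> applies. The odd component
  at \<open>N + 1\<close> is padding on which no derivative depends.\<close>

lemma homogeneous_solution_exists:
  fixes A :: "real^'e^'o" and L \<tau>o0 \<tau>oN :: "real^'o^'o" and \<tau>e0 \<tau>eN :: "real^'o^'e"
  shows "\<exists>uo ue. \<forall>T. semidiscrete_solution N Po Pe Qo Qe A L \<tau>o0 \<tau>oN \<tau>e0 \<tau>eN T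
    (\<lambda>_. 0) (\<lambda>_. 0) uo0 ue0 uo ue"
proof -
  \<comment> \<open>\<open>\<rho>0 j\<close> and \<open>\<rho>N j\<close> are the contributions of
    index \<open>j\<close> to the two boundary residuals; the right boundary node is
    \<open>N\<close> on the odd grid but \<open>N + 1\<close> on the even one.\<close>
  define \<rho>0 :: "nat \<Rightarrow> (real^'o) \<times> (real^'e) \<Rightarrow> real^'o"
    where "\<rho>0 j p = (if j = 0 then fst p + L *v (A *v snd p) else 0)" for j p
  define \<rho>N :: "nat \<Rightarrow> (real^'o) \<times> (real^'e) \<Rightarrow> real^'o"
    where "\<rho>N j p = (if j = N then fst p else 0) - (if j = N + 1 then L *v (A *v snd p) else 0)" for j p
  define Ko where "Ko i j p = sat_term N Po \<tau>o0 \<tau>oN (\<rho>0 j p) (\<rho>N j p) i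
      - sbp_diff Po Qo i j *\<^sub>R (A *v snd p)" for i j p
  \<comment> \<open>The cutoff \<open>j \<le> N\<close> discards the odd padding value.\<close>
  define Ke where "Ke i j p = sat_term (N + 1) Pe \<tau>e0 \<tau>eN (\<rho>0 j p) (\<rho>N j p) i
      - (if j \<le> N then sbp_diff Pe Qe i j else 0) *\<^sub>R (transpose A *v fst p)"
    for i j and p :: "(real^'o) \<times> (real^'e)"
  note mv_simps = matrix_vector_right_distrib matrix_vector_mult_scaleR
  have \<rho>: "linear (\<rho>0 j)" "linear (\<rho>N j)" for j
    by (rule linearI; auto simp: \<rho>0_def \<rho>N_def mv_simps scaleR_right_distrib scaleR_diff_right)+
  have A: "linear (\<lambda>p. c *\<^sub>R (A *v snd p))" "linear (\<lambda>p. c *\<^sub>R (transpose A *v fst p))" for c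
    by (rule linearI; auto simp: mv_simps scaleR_right_distrib)+
  have K: "bounded_linear (\<lambda>p. (Ko i j p, Ke i j p))" for i j
    unfolding Ko_def Ke_def
    by (intro bounded_linear_Pair linear_conv_bounded_linear[THEN iffD1] linear_compose_sub
        linear_sat_term \<rho> A)
  obtain y where y0: "\<And>i. y 0 i = (uo0 i, ue0 i)"
    and y: "\<And>t i. i \<le> N + 1 \<Longrightarrow>
      ((\<lambda>t. y t i) has_vector_derivative (\<Sum>j\<le>N + 1. (Ko i j (y t j), Ke i j (y t j)))) (at t)"
    using linear_grid_ode_exists[of "\<lambda>i j p. (Ko i j p, Ke i j p)" "\<lambda>i. (uo0 i, ue0 i)" "N + 1", OF K]
    by blast
  have res: "(\<Sum>j\<le>N + 1. \<rho>0 j (z j)) = fst (z 0) + L *v (A *v snd (z 0)) - 0"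
      "(\<Sum>j\<le>N + 1. \<rho>N j (z j)) = fst (z N) - L *v (A *v snd (z (N + 1))) - 0" for z
    by (simp_all add: \<rho>0_def \<rho>N_def sum_subtractf del: sum.atMost_Suc)
  have fo: "((\<lambda>t. fst (y t i)) has_vector_derivative
      sat_term N Po \<tau>o0 \<tau>oN (fst (y t 0) + L *v (A *v snd (y t 0)) - 0)
        (fst (y t N) - L *v (A *v snd (y t (N + 1))) - 0) i
      - grid_apply (N + 1) (sbp_diff Po Qo) (\<lambda>j. A *v snd (y t j)) i) (at t within {0..T})"
    if "i \<le> N + 1" for t i T
  proof -
    have "(\<Sum>j\<le>N + 1. Ko i j (y t j)) =
        sat_term N Po \<tau>o0 \<tau>oN (\<Sum>j\<le>N + 1. \<rho>0 j (y t j)) (\<Sum>j\<le>N + 1. \<rho>N j (y t j)) i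
        - grid_apply (N + 1) (sbp_diff Po Qo) (\<lambda>j. A *v snd (y t j)) i"
      by (simp only: Ko_def sum_subtractf sat_term_sum_residual grid_apply_def)
    then show ?thesis
      using bounded_linear.has_vector_derivative[OF bounded_linear_fst
          has_vector_derivative_at_within[OF y[OF that]], of t "{0..T}"]
      by (simp only: fst_sum fst_conv res)
  qed
  have fe: "((\<lambda>t. snd (y t i)) has_vector_derivative
      sat_term (N + 1) Pe \<tau>e0 \<tau>eN (fst (y t 0) + L *v (A *v snd (y t 0)) - 0)
        (fst (y t N) - L *v (A *v snd (y t (N + 1))) - 0) i
      - grid_apply N (sbp_diff Pe Qe) (\<lambda>j. transpose A *v fst (y t j)) i) (at t within {0..T})"
    if "i \<le> N + 1" for t i T
  proof -
    have "(\<Sum>j\<le>N + 1. (if j \<le> N then sbp_diff Pe Qe i j else 0) *\<^sub>R (transpose A *v fst (y t j)))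
        = grid_apply N (sbp_diff Pe Qe) (\<lambda>j. transpose A *v fst (y t j)) i"
      by (simp add: grid_apply_def)
    then have "(\<Sum>j\<le>N + 1. Ke i j (y t j)) =
        sat_term (N + 1) Pe \<tau>e0 \<tau>eN (\<Sum>j\<le>N + 1. \<rho>0 j (y t j)) (\<Sum>j\<le>N + 1. \<rho>N j (y t j)) i
        - grid_apply N (sbp_diff Pe Qe) (\<lambda>j. transpose A *v fst (y t j)) i"
      by (simp only: Ke_def sum_subtractf sat_term_sum_residual)
    then show ?thesis
      using bounded_linear.has_vector_derivative[OF bounded_linear_snd
          has_vector_derivative_at_within[OF y[OF that]], of t "{0..T}"]
      by (simp only: snd_sum snd_conv res)
  qed
  show ?thesis
    by (rule exI[of _ "\<lambda>t i. fst (y t i)"], rule exI[of _ "\<lambda>t i. snd (y t i)"])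
      (use fo fe in \<open>auto simp: semidiscrete_solution_def Let_def y0\<close>)
qed

section \<open>Necessity of the condition\<close>

text \<open>A positive rate at time 0 would push the energy of the source-free solution above its
  initial value shortly afterwards, whereas the bound then has no source term to make up for
  it.\<close>

lemma energy_bound_imp_rate_nonpos:
  fixes A :: "real^'e^'o" and L \<tau>o0 \<tau>oN :: "real^'o^'o"
    and w :: "nat \<Rightarrow> real^'o" and v :: "nat \<Rightarrow> real^'e"
  assumes sbp: "staggered_sbp xL xR N Po Pe Qo Qe" and "N \<ge> 1"
    and \<tau>e: "\<tau>e0 = - transpose (A + \<tau>o0 ** L ** A)" "\<tau>eN = transpose (A + \<tau>oN ** L ** A)"
    and bound: "energy_bound N Po Pe Qo Qe A L \<tau>o0 \<tau>oN \<tau>e0 \<tau>eN C"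
  shows "boundary_rate L \<tau>o0 0 (w 0) (A *v v 0) + boundary_rate L \<tau>oN 0 (w N) (- (A *v v (N + 1))) \<le> 0"
    (is "?l \<le> 0")
proof (rule ccontr)
  assume "\<not> ?l \<le> 0"
  obtain uo ue where sol: "\<And>T. semidiscrete_solution N Po Pe Qo Qe A L \<tau>o0 \<tau>oN \<tau>e0 \<tau>eN T
    (\<lambda>_. 0) (\<lambda>_. 0) w v uo ue"
    using homogeneous_solution_exists by blast
  have init: "uo 0 0 = w 0" "uo 0 N = w N" "ue 0 0 = v 0" "ue 0 (N + 1) = v (N + 1)"
    using sol[of 0] by (auto simp: semidiscrete_solution_def)
  have P: "diag_pos_def N Po" "diag_pos_def (N + 1) Pe"
    using sbp by (auto simp: staggered_sbp_def)
  have init_norm: "grid_norm_sq N Po (uo 0) = grid_norm_sq N Po w"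
      "grid_norm_sq (N + 1) Pe (ue 0) = grid_norm_sq (N + 1) Pe v"
    unfolding grid_norm_sq_diag[OF P(1)] grid_norm_sq_diag[OF P(2)]
    using sol[of 0] by (auto simp: semidiscrete_solution_def intro!: sum.cong)
  let ?E = "\<lambda>t. grid_norm_sq N Po (uo t) + grid_norm_sq (N + 1) Pe (ue t)"
  have "(?E has_real_derivative 2 * ?l) (at 0 within {0..1})"
    using energy_has_derivative[OF sbp assms(2) \<tau>e sol[of 1], of 0] by (simp add: init[simplified])
  with \<open>\<not> ?l \<le> 0\<close> obtain d where d: "d > 0" "\<And>h. h > 0 \<Longrightarrow> h \<in> {0..1} \<Longrightarrow> h < d \<Longrightarrow> ?E 0 < ?E h"
    using has_real_derivative_pos_inc_right[of ?E "2 * ?l" 0 "{0..1}"] by auto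
  \<comment> \<open>The derivative was taken on \<open>{0..1}\<close>, while the bound is used with
    final time \<open>h\<close>; the same solution serves both, as it does not depend on
    \<open>T\<close>.\<close>
  define h where "h = min (d / 2) 1"
  have h: "h > 0" "h \<in> {0..1}" "h < d"
    using d(1) by (auto simp: h_def)
  have src: "boundary_source L h (\<lambda>_. 0)"
    unfolding boundary_source_def by (auto intro: image_eqI[of _ _ 0])
  have "?E h \<le> grid_norm_sq N Po w + grid_norm_sq (N + 1) Pe v"
    using bound[unfolded energy_bound_def, rule_format, OF h(1) src src sol] by simp
  with d(2)[OF h] init_norm show False by simp
qed

text \<open>For \<open>v = 0\<close> the rate is \<open>w \<bullet> (\<tau> *v w)\<close>. For
  \<open>w = 0\<close> the residual is \<open>L *v v\<close>, and the rate is the left side minus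
  the right side of the second claim, taken at \<open>v\<close>.\<close>

lemma boundary_rate_nonpos_imp:
  fixes L \<tau> :: "real^'o^'o"
  assumes sym: "transpose L = L" and rate: "\<And>w v. boundary_rate L \<tau> 0 w v \<le> 0"
  shows "neg_semidefinite \<tau>"
    and "x \<bullet> ((L ** transpose (- \<tau>) ** L) *v x) \<le> x \<bullet> (L *v x)"
proof -
  show "neg_semidefinite \<tau>"
    unfolding neg_semidefinite_def
  proof
    fix x
    show "x \<bullet> (\<tau> *v x) \<le> 0"
      using rate[of x 0] by (simp add: boundary_rate_def)
  qed
  show "x \<bullet> ((L ** transpose (- \<tau>) ** L) *v x) \<le> x \<bullet> (L *v x)"
    using rate[of 0 x] inner_commute[of "L *v x" x] inner_commute[of "L *v x" "\<tau> *v (L *v x)"]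
    unfolding inner_conjugated_transpose_uminus[OF sym]
    by (simp add: boundary_rate_def Let_def inner_add_left)
qed

section \<open>Sufficiency by integration in time\<close>

lemma energy_boundI:
  fixes A :: "real^'e^'o" and L \<tau>o0 \<tau>oN :: "real^'o^'o"
  assumes sbp: "staggered_sbp xL xR N Po Pe Qo Qe" and "N \<ge> 1"
    and \<tau>e: "\<tau>e0 = - transpose (A + \<tau>o0 ** L ** A)" "\<tau>eN = transpose (A + \<tau>oN ** L ** A)"
    and rate: "\<And>\<tau> g w v. \<tau> \<in> {\<tau>o0, \<tau>oN} \<Longrightarrow> g \<in> range ((*v) L) \<Longrightarrow> 2 * boundary_rate L \<tau> g w v \<le> C * (g \<bullet> g)"
  shows "energy_bound N Po Pe Qo Qe A L \<tau>o0 \<tau>oN \<tau>e0 \<tau>eN C"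
  unfolding energy_bound_def
proof (intro allI impI)
  fix T :: real and gL gR uo0 ue0 uo ue
  assume T: "0 < T" and gL: "boundary_source L T gL" and gR: "boundary_source L T gR"
    and sol: "semidiscrete_solution N Po Pe Qo Qe A L \<tau>o0 \<tau>oN \<tau>e0 \<tau>eN T gL gR uo0 ue0 uo ue"
  have P: "diag_pos_def N Po" "diag_pos_def (N + 1) Pe"
    using sbp by (auto simp: staggered_sbp_def)
  have init_norm: "grid_norm_sq N Po (uo 0) = grid_norm_sq N Po uo0"
      "grid_norm_sq (N + 1) Pe (ue 0) = grid_norm_sq (N + 1) Pe ue0"
    unfolding grid_norm_sq_diag[OF P(1)] grid_norm_sq_diag[OF P(2)]
    using sol by (auto simp: semidiscrete_solution_def intro!: sum.cong)
  let ?E = "\<lambda>t. grid_norm_sq N Po (uo t) + grid_norm_sq (N + 1) Pe (ue t)"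
  let ?l = "\<lambda>t. 2 * (boundary_rate L \<tau>o0 (gL t) (uo t 0) (A *v ue t 0)
         + boundary_rate L \<tau>oN (gR t) (uo t N) (- (A *v ue t (N + 1))))"
  \<comment> \<open>The gauge integral of an everywhere existing derivative exists without
    continuity, so discontinuous sources cause no difficulty.\<close>
  have E: "(?l has_integral ?E T - ?E 0) {0..T}"
    using T energy_has_derivative[OF sbp assms(2) \<tau>e sol]
    by (intro fundamental_theorem_of_calculus)
      (auto simp: has_real_derivative_iff_has_vector_derivative simp del: One_nat_def)
  have I: "((\<lambda>t. C * (gL t \<bullet> gL t + gR t \<bullet> gR t)) has_integral
      C * (integral {0..T} (\<lambda>t. gL t \<bullet> gL t) + integral {0..T} (\<lambda>t. gR t \<bullet> gR t))) {0..T}"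
    using gL gR
    by (intro has_integral_mult_right has_integral_add integrable_integral
        set_lebesgue_integral_eq_integral(1)) (auto simp: boundary_source_def)
  have "?E T - ?E 0 \<le> C * (integral {0..T} (\<lambda>t. gL t \<bullet> gL t) + integral {0..T} (\<lambda>t. gR t \<bullet> gR t))"
  proof (rule has_integral_le[OF E I])
    fix t assume t: "t \<in> {0..T}"
    then have "gL t \<in> range ((*v) L)" "gR t \<in> range ((*v) L)"
      using gL gR by (auto simp: boundary_source_def)
    then show "?l t \<le> C * (gL t \<bullet> gL t + gR t \<bullet> gR t)"
      using rate[of \<tau>o0 "gL t" "uo t 0" "A *v ue t 0"]
        rate[of \<tau>oN "gR t" "uo t N" "- (A *v ue t (N + 1))"]
      by (simp add: distrib_left)
  qed
  then show "?E T \<le> grid_norm_sq N Po uo0 + grid_norm_sq (N + 1) Pe ue0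
      + C * (integral {0..T} (\<lambda>t. gL t \<bullet> gL t) + integral {0..T} (\<lambda>t. gR t \<bullet> gR t))"
    by (simp add: init_norm[simplified])
qed

text \<open>The converse is stated for symmetric penalties because completing the squares moves
  \<open>\<tau>\<close> across the inner product.\<close>

theorem theorem10:
  fixes xL xR :: real and N :: nat
    and Po Pe Qo Qe :: "nat \<Rightarrow> nat \<Rightarrow> real"
    and A :: "real^'e^'o" and L Lp \<tau>o0 \<tau>oN :: "real^'o^'o" and \<tau>e0 \<tau>eN :: "real^'o^'e"
    and C :: real
  assumes "xL < xR" and "N \<ge> 1"
    and "staggered_sbp xL xR N Po Pe Qo Qe"
    and "CARD('o) \<le> CARD('e)" and "rank A = CARD('o)"
    and "transpose L = L" and "pos_semidefinite L"
    and "is_pseudo_inverse L Lp"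
    and "\<tau>e0 = - transpose (A + \<tau>o0 ** L ** A)"
    and "\<tau>eN = transpose (A + \<tau>oN ** L ** A)"
    and "C = Max {onorm ((*v) \<tau>o0), onorm ((*v) \<tau>oN),
                  onorm ((*v) (Lp + transpose \<tau>o0)), onorm ((*v) (Lp + transpose \<tau>oN))}"
  shows "let bound = energy_bound N Po Pe Qo Qe A L \<tau>o0 \<tau>oN \<tau>e0 \<tau>eN C;
             condition = (\<forall>\<tau>\<in>{\<tau>o0, \<tau>oN}. neg_semidefinite \<tau> \<and>
               (\<forall>x. x \<bullet> ((L ** transpose (- \<tau>) ** L) *v x) \<le> x \<bullet> (L *v x)))
         in (bound \<longrightarrow> condition) \<and>
            (transpose \<tau>o0 = \<tau>o0 \<and> transpose \<tau>oN = \<tau>oN \<longrightarrow> (bound \<longleftrightarrow> condition))"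
proof -
  let ?bound = "energy_bound N Po Pe Qo Qe A L \<tau>o0 \<tau>oN \<tau>e0 \<tau>eN C"
  let ?cond = "\<forall>\<tau>\<in>{\<tau>o0, \<tau>oN}. neg_semidefinite \<tau> \<and>
               (\<forall>x. x \<bullet> ((L ** transpose (- \<tau>) ** L) *v x) \<le> x \<bullet> (L *v x))"
  have necessity: "?cond" if bound: ?bound
  proof -
    \<comment> \<open>Full row rank makes every vector attainable as a trace
      \<open>A *v y\<close>.\<close>
    have surj: "\<exists>y. A *v y = x" for x
      using full_rank_surjective[of A] assms(5) by (metis surj_def)
    note rate = energy_bound_imp_rate_nonpos[OF assms(3,2,9,10) bound]
    have zero: "boundary_rate L \<tau> 0 0 0 = 0" for \<tau>
      by (simp add: boundary_rate_def)
    \<comment> \<open>Data supported at the left boundary node isolate the left rate: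
      \<open>N \<ge> 1\<close> separates the ends, so the right one contributes nothing by
      \<open>zero\<close>.\<close>
    have "boundary_rate L \<tau>o0 0 w v \<le> 0" for w v
    proof -
      obtain y where "A *v y = v" using surj by blast
      then show ?thesis
        using rate[of "\<lambda>i. if i = 0 then w else 0" "\<lambda>i. if i = 0 then y else 0"] assms(2) zero
        by simp
    qed
    moreover have "boundary_rate L \<tau>oN 0 w v \<le> 0" for w v
    proof -
      \<comment> \<open>The sign compensates for the minus with which the trace at the right end
        enters the rate.\<close>
      obtain y where "A *v y = - v" using surj by blast
      then show ?thesis
        using rate[of "\<lambda>i. if i = N then w else 0" "\<lambda>i. if i = N + 1 then y else 0"] assms(2) zero
        by simp
    qed
    ultimately show ?thesis
      using boundary_rate_nonpos_imp[OF assms(6)] by blast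
  qed
  have sufficiency: ?bound if sym: "transpose \<tau>o0 = \<tau>o0" "transpose \<tau>oN = \<tau>oN" and cond: ?cond
  proof (rule energy_boundI[OF assms(3,2,9,10)])
    fix \<tau> g w v assume \<tau>: "\<tau> \<in> {\<tau>o0, \<tau>oN}" and g: "g \<in> range ((*v) L)"
    have "onorm ((*v) \<tau>) \<le> C" "onorm ((*v) (Lp + transpose \<tau>)) \<le> C"
      using \<tau> unfolding assms(11) by (intro Max_ge; auto)+
    with \<tau> g sym cond assms(6,8) show "2 * boundary_rate L \<tau> g w v \<le> C * (g \<bullet> g)"
      by (intro boundary_rate_le) auto
  qed
  show ?thesis
    unfolding Let_def
    by (intro conjI impI iffI) ((rule necessity; assumption) | (elim conjE, rule sufficiency; assumption))+
qed

end
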